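(* Let $n\ge 2$. For any real numbers $x_1,x_2,\dots,x_n$ with $x_1+x_2+\cdots+x_n=0$, we have $$\frac{1}{n!}\sum_{\sigma}\max_{2\le k\le n}\left|\frac{\left(\sum_{i=1}^k x_{\sigma(i)}\right)^2-\frac{n-k}{n-1}\sum_{i=1}^k x_{\sigma(i)}^2}{k(k-1)}\right|^2\le\frac{4}{(n-1)^2}\left\{\left(\sum_{i=1}^n x_i^2\right)^2-\sum_{i=1}^n x_i^4\right\},$$ where the first sum is taken over all permutations $\sigma$ of $\{1,\dots,n\}$.
   Context: The $x_i$ need not be distinct. *)

theory Defs
  imports Complex_Main "HOL-Combinatorics.Permutations"
begin

end

theory Submission
  imports Defs
begin

text \<open>
  The quotient inside the maximum depends on \<open>\<sigma>\<close> only through the set \<open>\<sigma> ` {1..k}\<close>, and its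
  value at a set \<open>K\<close> is the average of its values at the sets \<open>K - {j}\<close> with \<open>j \<in> K\<close>. So, for
  a uniformly random \<open>\<sigma>\<close>, it is a martingale when \<open>k\<close> runs from \<open>n\<close> down to \<open>2\<close>, and Doob's
  \<open>L\<^sup>2\<close> maximal inequality bounds the left-hand side by four times the second moment of its last
  term \<open>x\<^bsub>\<sigma>(1)\<^esub> x\<^bsub>\<sigma>(2)\<^esub> + (x\<^bsub>\<sigma>(1)\<^esub>\<^sup>2 + x\<^bsub>\<sigma>(2)\<^esub>\<^sup>2) / (2(n-1))\<close>, which is computed
  explicitly. Doob's inequality is obtained from a pathwise inequality whose correction term is a
  sum of martingale increments with predictable coefficients, hence has mean zero.
\<close>

section \<open>Doob's maximal inequality along a random permutation, with time running
  downwards\<close>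

text \<open>The coefficient \<open>b k n * sgn (a k)\<close> depends only on the values
  \<open>a l\<close> with \<open>l \<ge> k\<close>, which precede \<open>a (k - 1)\<close> in
  downward time. This predictability lets the correction sum vanish on average for a
  martingale.\<close>

lemma pathwise_maximal_inequality:
  fixes a :: "nat \<Rightarrow> real"
  defines "b \<equiv> \<lambda>k n. Max ((\<lambda>l. \<bar>a l\<bar>) ` {k..n})"
  assumes "m \<le> n"
  shows "(b m n)\<^sup>2 \<le> 4 * (a m)\<^sup>2 - 4 * (\<Sum>k=Suc m..n. b k n * sgn (a k) * (a (k - 1) - a k))"
proof -
  \<comment> \<open>This bound by the maximum times the final value propagates by induction from
    \<open>n\<close> down to \<open>m\<close>. The factor \<open>b m n\<close> on the right is
    absorbed only at the end.\<close>
  have "(b m n)\<^sup>2 \<le> 2 * b m n * \<bar>a m\<bar> - 2 * (\<Sum>k=Suc m..n. b k n * sgn (a k) * (a (k - 1) - a k))"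
    using assms(2)
  proof (induction m rule: inc_induct)
    case base
    show ?case by (simp add: b_def power2_eq_square mult.assoc)
  next
    case (step m)
    let ?D = "\<lambda>k. b k n * sgn (a k) * (a (k - 1) - a k)"
    have ivl: "{m..n} = insert m {Suc m..n}" "{Suc m..n} = insert (Suc m) {Suc (Suc m)..n}"
      using step.hyps by auto
    have b: "b m n = max \<bar>a m\<bar> (b (Suc m) n)"
      unfolding b_def ivl(1) using step.hyps by (simp add: Max_insert)
    have b_nonneg: "0 \<le> b (Suc m) n"
      unfolding b_def ivl(2) using step.hyps by (auto simp: Max_ge_iff)
    \<comment> \<open>Convexity: \<open>sgn (a (Suc m))\<close> is a subgradient of the absolute
      value at \<open>a (Suc m)\<close>.\<close>
    have "sgn (a (Suc m)) * (a m - a (Suc m)) \<le> \<bar>a m\<bar> - \<bar>a (Suc m)\<bar>"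
      by (auto simp: sgn_if)
    then have "b (Suc m) n * (sgn (a (Suc m)) * (a m - a (Suc m)))
        \<le> b (Suc m) n * (\<bar>a m\<bar> - \<bar>a (Suc m)\<bar>)"
      using b_nonneg by (rule mult_left_mono)
    then have D: "?D (Suc m) \<le> b (Suc m) n * \<bar>a m\<bar> - b (Suc m) n * \<bar>a (Suc m)\<bar>"
      by (simp add: algebra_simps)
    have "(b m n)\<^sup>2 - 2 * b m n * \<bar>a m\<bar> + 2 * (b (Suc m) n * \<bar>a m\<bar>) \<le> (b (Suc m) n)\<^sup>2"
    proof (cases "\<bar>a m\<bar> \<le> b (Suc m) n")
      case True
      then show ?thesis using b by simp
    next
      case False
      then have "b m n = \<bar>a m\<bar>" using b by simp
      then show ?thesis
        using zero_le_power2[of "\<bar>a m\<bar> - b (Suc m) n"]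
        by (simp add: power2_eq_square algebra_simps)
    qed
    moreover have "(\<Sum>k=Suc m..n. ?D k) = ?D (Suc m) + (\<Sum>k=Suc (Suc m)..n. ?D k)"
      unfolding ivl(2) by simp
    ultimately show ?case using step.IH D by linarith
  qed
  \<comment> \<open>The weights are chosen so that half of the squared maximum moves to the left;
    doubling then gives the constant 4.\<close>
  moreover have "2 * b m n * \<bar>a m\<bar> \<le> (b m n)\<^sup>2 / 2 + 2 * (a m)\<^sup>2"
    using zero_le_power2[of "b m n - 2 * \<bar>a m\<bar>"] by (simp add: power2_eq_square algebra_simps)
  ultimately show ?thesis by linarith
qed

lemma sum_permutes_martingale_increment:
  fixes F :: "nat set \<Rightarrow> real" and H :: "(nat \<Rightarrow> nat) \<Rightarrow> real"
  assumes k: "1 \<le> k" "k \<le> n"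
    and F: "\<And>K. K \<subseteq> {1..n} \<Longrightarrow> card K = k \<Longrightarrow> (\<Sum>j\<in>K. F (K - {j})) = real k * F K"
    and H: "\<And>\<sigma> \<tau>. \<sigma> permutes {1..n} \<Longrightarrow> \<tau> permutes {1..k} \<Longrightarrow> H (\<sigma> \<circ> \<tau>) = H \<sigma>"
  shows "(\<Sum>\<sigma> | \<sigma> permutes {1..n}. H \<sigma> * (F (\<sigma> ` {1..k - 1}) - F (\<sigma> ` {1..k}))) = 0"
proof -
  let ?P = "{\<sigma>. \<sigma> permutes {1..n}}"
  have eq: "(\<Sum>\<sigma>\<in>?P. H \<sigma> * F (\<sigma> ` {1..k - 1})) = (\<Sum>\<sigma>\<in>?P. H \<sigma> * F (\<sigma> ` {1..k} - {\<sigma> j}))"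
    if j: "j \<in> {1..k}" for j
  proof -
    let ?t = "Transposition.transpose j k"
    have t: "?t permutes {1..k}" by (rule permutes_swap_id) (use j k in auto)
    have tn: "?t permutes {1..n}" by (rule permutes_swap_id) (use j k in auto)
    have "{1..k - 1} = {1..k} - {k}" using k by auto
    then have im: "?t ` {1..k - 1} = {1..k} - {j}"
      by (simp only: image_set_diff[OF permutes_inj[OF t]] permutes_image[OF t]) simp
    have "(\<Sum>\<sigma>\<in>?P. H \<sigma> * F (\<sigma> ` {1..k - 1}))
        = (\<Sum>\<sigma>\<in>?P. H (\<sigma> \<circ> ?t) * F ((\<sigma> \<circ> ?t) ` {1..k - 1}))"
      by (rule sum_permutations_compose_right[OF tn])
    also have "\<dots> = (\<Sum>\<sigma>\<in>?P. H \<sigma> * F (\<sigma> ` {1..k} - {\<sigma> j}))"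
    proof (rule sum.cong)
      fix \<sigma> assume "\<sigma> \<in> ?P"
      then have s: "\<sigma> permutes {1..n}" by simp
      have "(\<sigma> \<circ> ?t) ` {1..k - 1} = \<sigma> ` {1..k} - {\<sigma> j}"
        unfolding image_comp[symmetric] im by (simp add: image_set_diff permutes_inj[OF s])
      then show "H (\<sigma> \<circ> ?t) * F ((\<sigma> \<circ> ?t) ` {1..k - 1}) = H \<sigma> * F (\<sigma> ` {1..k} - {\<sigma> j})"
        using H[OF s t] by simp
    qed simp
    finally show ?thesis .
  qed
  have avg: "(\<Sum>j=1..k. F (\<sigma> ` {1..k} - {\<sigma> j})) = real k * F (\<sigma> ` {1..k})"
    if "\<sigma> \<in> ?P" for \<sigma>
  proof -
    have s: "\<sigma> permutes {1..n}" using that by simp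
    have inj: "inj_on \<sigma> {1..k}" using permutes_inj[OF s] by (rule inj_on_subset) simp
    have "\<sigma> ` {1..k} \<subseteq> \<sigma> ` {1..n}" using k by (intro image_mono) auto
    then have "\<sigma> ` {1..k} \<subseteq> {1..n}" unfolding permutes_image[OF s] .
    moreover have "card (\<sigma> ` {1..k}) = k" using card_image[OF inj] by simp
    ultimately have "(\<Sum>j\<in>\<sigma> ` {1..k}. F (\<sigma> ` {1..k} - {j})) = real k * F (\<sigma> ` {1..k})"
      by (rule F)
    then show ?thesis unfolding sum.reindex[OF inj] o_def .
  qed
  have "real k * (\<Sum>\<sigma>\<in>?P. H \<sigma> * F (\<sigma> ` {1..k - 1}))
      = (\<Sum>j=1..k. \<Sum>\<sigma>\<in>?P. H \<sigma> * F (\<sigma> ` {1..k - 1}))"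
    by simp
  also have "\<dots> = (\<Sum>j=1..k. \<Sum>\<sigma>\<in>?P. H \<sigma> * F (\<sigma> ` {1..k} - {\<sigma> j}))"
    by (rule sum.cong[OF refl eq])
  also have "\<dots> = (\<Sum>\<sigma>\<in>?P. H \<sigma> * (\<Sum>j=1..k. F (\<sigma> ` {1..k} - {\<sigma> j})))"
    by (subst sum.swap) (simp add: sum_distrib_left)
  also have "\<dots> = real k * (\<Sum>\<sigma>\<in>?P. H \<sigma> * F (\<sigma> ` {1..k}))"
    using avg by (simp add: sum_distrib_left algebra_simps)
  finally show ?thesis
    using k by (simp add: right_diff_distrib sum_subtractf)
qed

lemma sum_permutes_maximal_inequality:
  fixes F :: "nat set \<Rightarrow> real"
  assumes "m \<le> n"
    and F: "\<And>K. K \<subseteq> {1..n} \<Longrightarrow> m < card K \<Longrightarrow> (\<Sum>j\<in>K. F (K - {j})) = real (card K) * F K"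
  shows "(\<Sum>\<sigma> | \<sigma> permutes {1..n}. MAX k\<in>{m..n}. \<bar>F (\<sigma> ` {1..k})\<bar>\<^sup>2)
    \<le> 4 * (\<Sum>\<sigma> | \<sigma> permutes {1..n}. (F (\<sigma> ` {1..m}))\<^sup>2)"
proof -
  let ?P = "{\<sigma>. \<sigma> permutes {1..n}}"
  define a where "a \<sigma> k = F (\<sigma> ` {1..k})" for \<sigma> :: "nat \<Rightarrow> nat" and k
  define b where "b \<sigma> k = Max ((\<lambda>l. \<bar>a \<sigma> l\<bar>) ` {k..n})" for \<sigma> :: "nat \<Rightarrow> nat" and k
  \<comment> \<open>Reordering the first \<open>k\<close> positions does not change the image of any
    longer initial segment, so every quantity built from times \<open>l \<ge> k\<close> qualifies as
    a coefficient \<open>H\<close>.\<close>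
  have a_inv: "a (\<sigma> \<circ> \<tau>) l = a \<sigma> l" if "\<tau> permutes {1..k}" "k \<le> l" for \<sigma> \<tau> k l
  proof -
    have "\<tau> permutes {1..l}" by (rule permutes_subset[OF that(1)]) (use that(2) in auto)
    then show ?thesis unfolding a_def image_comp[symmetric] by (simp only: permutes_image)
  qed
  have mean_zero: "(\<Sum>\<sigma>\<in>?P. b \<sigma> k * sgn (a \<sigma> k) * (a \<sigma> (k - 1) - a \<sigma> k)) = 0"
    if k: "k \<in> {Suc m..n}" for k
  proof -
    have "b (\<sigma> \<circ> \<tau>) k * sgn (a (\<sigma> \<circ> \<tau>) k) = b \<sigma> k * sgn (a \<sigma> k)"
      if "\<tau> permutes {1..k}" for \<sigma> \<tau>
    proof -
      have "b (\<sigma> \<circ> \<tau>) k = b \<sigma> k"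
        unfolding b_def by (intro arg_cong[where f = Max] image_cong) (use a_inv[OF that] in auto)
      then show ?thesis using a_inv[OF that] by simp
    qed
    then have "(\<Sum>\<sigma>\<in>?P. b \<sigma> k * sgn (a \<sigma> k) * (F (\<sigma> ` {1..k - 1}) - F (\<sigma> ` {1..k}))) = 0"
      by (intro sum_permutes_martingale_increment) (use k F in auto)
    then show ?thesis by (simp only: a_def)
  qed
  have "(\<Sum>\<sigma>\<in>?P. MAX k\<in>{m..n}. \<bar>a \<sigma> k\<bar>\<^sup>2)
      \<le> (\<Sum>\<sigma>\<in>?P. 4 * (a \<sigma> m)\<^sup>2
          - 4 * (\<Sum>k=Suc m..n. b \<sigma> k * sgn (a \<sigma> k) * (a \<sigma> (k - 1) - a \<sigma> k)))"
  proof (rule sum_mono)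
    fix \<sigma>
    have "(MAX k\<in>{m..n}. \<bar>a \<sigma> k\<bar>\<^sup>2) \<le> (b \<sigma> m)\<^sup>2"
    proof (rule Max.boundedI)
      have "\<bar>a \<sigma> k\<bar>\<^sup>2 \<le> (b \<sigma> m)\<^sup>2" if "k \<in> {m..n}" for k
        unfolding b_def by (intro power_mono Max_ge imageI that) simp_all
      then show "t \<le> (b \<sigma> m)\<^sup>2" if "t \<in> (\<lambda>k. \<bar>a \<sigma> k\<bar>\<^sup>2) ` {m..n}" for t
        using that by blast
    qed (use \<open>m \<le> n\<close> in auto)
    also have "\<dots> \<le> 4 * (a \<sigma> m)\<^sup>2
        - 4 * (\<Sum>k=Suc m..n. b \<sigma> k * sgn (a \<sigma> k) * (a \<sigma> (k - 1) - a \<sigma> k))"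
      unfolding b_def by (rule pathwise_maximal_inequality[OF \<open>m \<le> n\<close>])
    finally show "(MAX k\<in>{m..n}. \<bar>a \<sigma> k\<bar>\<^sup>2) \<le> \<dots>" .
  qed
  also have "\<dots> = 4 * (\<Sum>\<sigma>\<in>?P. (a \<sigma> m)\<^sup>2)
      - 4 * (\<Sum>k=Suc m..n. \<Sum>\<sigma>\<in>?P. b \<sigma> k * sgn (a \<sigma> k) * (a \<sigma> (k - 1) - a \<sigma> k))"
    by (subst sum.swap) (simp only: sum_subtractf sum_distrib_left)
  also have "\<dots> = 4 * (\<Sum>\<sigma>\<in>?P. (a \<sigma> m)\<^sup>2)"
    using mean_zero by simp
  finally show ?thesis by (simp add: a_def)
qed

section \<open>Averages over permutations of functions of two positions\<close>

lemma ex_permutes_two_points: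
  assumes "a \<in> A" "b \<in> A" "a \<noteq> b" "i \<in> A" "j \<in> A" "i \<noteq> j"
  shows "\<exists>\<tau>. \<tau> permutes A \<and> \<tau> a = i \<and> \<tau> b = j"
proof -
  \<comment> \<open>\<open>?t\<close> moves \<open>a\<close> to \<open>i\<close>. Applied
    beforehand, \<open>?s\<close> fixes \<open>a\<close> and sends \<open>b\<close> to
    \<open>?t j\<close>, which \<open>?t\<close> then carries to \<open>j\<close>.\<close>
  let ?t = "Transposition.transpose i a"
  let ?s = "Transposition.transpose (?t j) b"
  have t: "?t permutes A" by (rule permutes_swap_id) (use assms in auto)
  have s: "?s permutes A"
    by (rule permutes_swap_id) (use assms permutes_in_image[OF t] in auto)
  have "?t j \<noteq> a" using assms by (auto simp: Transposition.transpose_def)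
  then have "(?t \<circ> ?s) a = i" using assms by simp
  moreover have "(?t \<circ> ?s) b = j" by simp
  ultimately show ?thesis using permutes_compose[OF s t] by blast
qed

text \<open>By double transitivity the sum over permutations is the same for every ordered pair of
  distinct positions. Summing it over all such pairs and exchanging the sums, each permutation
  merely reindexes the off-diagonal sum of \<open>g\<close>.\<close>

lemma sum_permutes_two_points:
  fixes g :: "'a \<Rightarrow> 'a \<Rightarrow> real"
  assumes "finite A" and ab: "a \<in> A" "b \<in> A" "a \<noteq> b"
  shows "real (card A) * (real (card A) - 1) * (\<Sum>\<sigma> | \<sigma> permutes A. g (\<sigma> a) (\<sigma> b))
    = fact (card A) * (\<Sum>i\<in>A. \<Sum>j\<in>A - {i}. g i j)"
proof -
  let ?P = "{\<sigma>. \<sigma> permutes A}"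
  let ?E = "\<Sum>\<sigma>\<in>?P. g (\<sigma> a) (\<sigma> b)"
  have eq: "(\<Sum>\<sigma>\<in>?P. g (\<sigma> i) (\<sigma> j)) = ?E" if ij: "i \<in> A" "j \<in> A - {i}" for i j
  proof -
    obtain \<tau> where \<tau>: "\<tau> permutes A" "\<tau> a = i" "\<tau> b = j"
      using ex_permutes_two_points[OF ab, of i j] ij by blast
    show ?thesis
      using sum_permutations_compose_right[OF \<tau>(1), of "\<lambda>\<sigma>. g (\<sigma> a) (\<sigma> b)"] \<tau> by simp
  qed
  have card: "real (card A - Suc 0) = real (card A) - 1"
    using assms by (cases "card A") auto
  have reindex: "(\<Sum>i\<in>A. \<Sum>j\<in>A - {i}. g (\<sigma> i) (\<sigma> j)) = (\<Sum>i\<in>A. \<Sum>j\<in>A - {i}. g i j)"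
    if "\<sigma> permutes A" for \<sigma>
  proof -
    have "(\<Sum>i\<in>A. \<Sum>j\<in>A - {i}. g i j) = (\<Sum>i\<in>\<sigma> ` A. \<Sum>j\<in>\<sigma> ` A - {i}. g i j)"
      by (simp add: permutes_image[OF that])
    also have "\<dots> = (\<Sum>i\<in>A. \<Sum>j\<in>\<sigma> ` (A - {i}). g (\<sigma> i) j)"
      by (simp add: sum.reindex permutes_inj_on[OF that] image_set_diff permutes_inj[OF that])
    also have "\<dots> = (\<Sum>i\<in>A. \<Sum>j\<in>A - {i}. g (\<sigma> i) (\<sigma> j))"
      by (simp only: sum.reindex permutes_inj_on[OF that] o_def)
    finally show ?thesis ..
  qed
  have "real (card A) * (real (card A) - 1) * ?E = (\<Sum>i\<in>A. \<Sum>j\<in>A - {i}. ?E)"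
    using \<open>finite A\<close> card by simp
  also have "\<dots> = (\<Sum>i\<in>A. \<Sum>j\<in>A - {i}. \<Sum>\<sigma>\<in>?P. g (\<sigma> i) (\<sigma> j))"
    by (intro sum.cong refl eq[symmetric])
  also have "\<dots> = (\<Sum>i\<in>A. \<Sum>\<sigma>\<in>?P. \<Sum>j\<in>A - {i}. g (\<sigma> i) (\<sigma> j))"
    by (intro sum.cong refl sum.swap)
  also have "\<dots> = (\<Sum>\<sigma>\<in>?P. \<Sum>i\<in>A. \<Sum>j\<in>A - {i}. g (\<sigma> i) (\<sigma> j))"
    by (rule sum.swap)
  also have "\<dots> = (\<Sum>\<sigma>\<in>?P. \<Sum>i\<in>A. \<Sum>j\<in>A - {i}. g i j)"
    by (rule sum.cong) (use reindex in auto)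
  also have "\<dots> = fact (card A) * (\<Sum>i\<in>A. \<Sum>j\<in>A - {i}. g i j)"
    by (simp add: card_permutations[OF refl \<open>finite A\<close>])
  finally show ?thesis .
qed

section \<open>The statistic and its martingale property\<close>

text \<open>For \<open>n \<ge> 2\<close> and \<open>card K \<ge> 2\<close> this is a U-statistic:
  the average of \<open>x i * x j + ((x i)\<^sup>2 + (x j)\<^sup>2) / (2 * (n - 1))\<close> over
  ordered pairs of distinct \<open>i\<close>, \<open>j\<close> in \<open>K\<close>.\<close>

definition prefix_stat :: "nat \<Rightarrow> ('a \<Rightarrow> real) \<Rightarrow> 'a set \<Rightarrow> real" where
  "prefix_stat n x K = ((\<Sum>i\<in>K. x i)\<^sup>2 - (real n - real (card K)) / (real n - 1) * (\<Sum>i\<in>K. (x i)\<^sup>2))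
    / (real (card K) * (real (card K) - 1))"

lemma prefix_stat_average:
  assumes "2 \<le> n" "2 < card K"
  shows "(\<Sum>j\<in>K. prefix_stat n x (K - {j})) = real (card K) * prefix_stat n x K"
proof -
  have fin: "finite K" using assms(2) by (rule_tac ccontr) simp
  define k where "k = real (card K)"
  define S where "S = (\<Sum>i\<in>K. x i)"
  define Q where "Q = (\<Sum>i\<in>K. (x i)\<^sup>2)"
  \<comment> \<open>\<open>c\<close> and \<open>d\<close> are the weights of the sum of squares for
    sets of size \<open>k - 1\<close> and \<open>k\<close>.\<close>
  define c where "c = (real n - k + 1) / (real n - 1)"
  define d where "d = (real n - k) / (real n - 1)"
  have k: "k > 2" using assms(2) by (simp add: k_def)
  have "prefix_stat n x (K - {j}) = (S\<^sup>2 - 2 * S * x j + (x j)\<^sup>2 - c * Q + c * (x j)\<^sup>2) / ((k - 1) * (k - 2))"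
    if "j \<in> K" for j
  proof -
    have "real (card (K - {j})) = k - 1"
      using that fin assms(2) by (simp add: k_def of_nat_diff)
    moreover have "(\<Sum>i\<in>K - {j}. x i) = S - x j" "(\<Sum>i\<in>K - {j}. (x i)\<^sup>2) = Q - (x j)\<^sup>2"
      using that fin by (simp_all add: S_def Q_def sum_diff1)
    moreover have "real n - (k - 1) = real n - k + 1" "k - 1 - 1 = k - 2" by simp_all
    ultimately show ?thesis
      by (simp only: prefix_stat_def c_def[symmetric]) (simp add: power2_diff algebra_simps)
  qed
  then have "(\<Sum>j\<in>K. prefix_stat n x (K - {j}))
      = (\<Sum>j\<in>K. S\<^sup>2 - 2 * S * x j + (x j)\<^sup>2 - c * Q + c * (x j)\<^sup>2) / ((k - 1) * (k - 2))"
    by (simp add: sum_divide_distrib)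
  also have "(\<Sum>j\<in>K. S\<^sup>2 - 2 * S * x j + (x j)\<^sup>2 - c * Q + c * (x j)\<^sup>2)
      = k * S\<^sup>2 - 2 * S * S + Q - k * (c * Q) + c * Q"
    by (simp add: sum.distrib sum_subtractf sum_distrib_left[symmetric] k_def S_def Q_def)
  also have "\<dots> = (k - 2) * (S\<^sup>2 - d * Q)"
  proof -
    \<comment> \<open>This relation between consecutive weights is what makes the average reproduce
      the statistic: it extracts the factor \<open>k - 2\<close>, which cancels against the
      denominator.\<close>
    have "1 - (k - 1) * c = - (k - 2) * d"
      using assms(1) by (simp add: c_def d_def field_simps)
    then have "(1 - (k - 1) * c) * Q = - (k - 2) * d * Q"
      by (simp only:)
    then show ?thesis by (simp add: algebra_simps power2_eq_square)
  qed
  also have "\<dots> / ((k - 1) * (k - 2)) = k * prefix_stat n x K"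
    using k by (simp add: prefix_stat_def d_def k_def[symmetric] S_def[symmetric] Q_def[symmetric])
  finally show ?thesis by (simp add: k_def)
qed

section \<open>The second moment of the final term\<close>

text \<open>After expanding the square, the zero sum reduces the mixed terms with odd powers to
  multiples of fourth powers. The total is exactly \<open>(1 + 1 / (2 * m\<^sup>2)) * (T\<^sup>2 -
  B) - 3 / (2 * m) * B\<close>, whose last term is discarded.\<close>

lemma sum_sum_off_diagonal_square_le:
  fixes x :: "'a \<Rightarrow> real"
  assumes "finite A" "2 \<le> card A" and zero: "(\<Sum>i\<in>A. x i) = 0"
  defines "m \<equiv> real (card A) - 1"
  shows "(\<Sum>i\<in>A. \<Sum>j\<in>A - {i}. (x i * x j + ((x i)\<^sup>2 + (x j)\<^sup>2) / (2 * m))\<^sup>2)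
    \<le> real (card A) / m * ((\<Sum>i\<in>A. (x i)\<^sup>2)\<^sup>2 - (\<Sum>i\<in>A. x i ^ 4))"
proof -
  define T where "T = (\<Sum>i\<in>A. (x i)\<^sup>2)"
  define B where "B = (\<Sum>i\<in>A. x i ^ 4)"
  have m: "m \<ge> 1" and card: "real (card A) = m + 1"
    using assms(2) by (simp_all add: m_def)
  have B_nonneg: "0 \<le> B" by (simp add: B_def sum_nonneg)
  have sq: "(\<Sum>i\<in>A. \<Sum>j\<in>A - {i}. (x i)\<^sup>2 * (x j)\<^sup>2) = T\<^sup>2 - B"
  proof -
    have "(\<Sum>j\<in>A - {i}. (x i)\<^sup>2 * (x j)\<^sup>2) = (x i)\<^sup>2 * T - x i ^ 4" if "i \<in> A" for i
      using that \<open>finite A\<close>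
      by (simp add: sum_diff1 sum_distrib_left[symmetric] T_def power2_eq_square power4_eq_xxxx
          right_diff_distrib)
    then show ?thesis
      by (simp add: sum_subtractf sum_distrib_right[symmetric] B_def flip: T_def)
        (simp add: power2_eq_square)
  qed
  have TB: "0 \<le> T\<^sup>2 - B"
    unfolding sq[symmetric] by (intro sum_nonneg) auto
  have expand: "(x i * x j + ((x i)\<^sup>2 + (x j)\<^sup>2) / (2 * m))\<^sup>2
      = (1 + 1 / (2 * m\<^sup>2)) * ((x i)\<^sup>2 * (x j)\<^sup>2) + (x i ^ 3 / m) * x j + (x i / m) * x j ^ 3
        + (1 / (4 * m\<^sup>2)) * x i ^ 4 + (1 / (4 * m\<^sup>2)) * x j ^ 4" for i j
    using m by (simp add: field_simps power2_eq_square power3_eq_cube power4_eq_xxxx)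
  \<comment> \<open>Each of the two odd mixed terms contributes \<open>- x i ^ 4 / m\<close>. The
    remaining \<open>x i * ((\<Sum>j\<in>A. x j ^ 3) / m)\<close> vanishes once summed over
    \<open>i\<close>.\<close>
  have inner: "(\<Sum>j\<in>A - {i}. (x i * x j + ((x i)\<^sup>2 + (x j)\<^sup>2) / (2 * m))\<^sup>2)
      = (1 + 1 / (2 * m\<^sup>2)) * (\<Sum>j\<in>A - {i}. (x i)\<^sup>2 * (x j)\<^sup>2)
        - 2 / m * x i ^ 4 + x i * ((\<Sum>j\<in>A. x j ^ 3) / m)
        + 1 / (4 * m) * x i ^ 4 + 1 / (4 * m\<^sup>2) * (B - x i ^ 4)" if "i \<in> A" for i
  proof -
    have c: "real (card (A - {i})) = m"
      using that assms(1,2) by (simp add: m_def of_nat_diff)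
    have s: "(\<Sum>j\<in>A - {i}. x j) = - x i" "(\<Sum>j\<in>A - {i}. x j ^ 3) = (\<Sum>j\<in>A. x j ^ 3) - x i ^ 3"
      "(\<Sum>j\<in>A - {i}. x j ^ 4) = B - x i ^ 4"
      using that \<open>finite A\<close> zero by (simp_all add: sum_diff1 B_def)
    show ?thesis
      unfolding expand sum.distrib sum_distrib_left[symmetric] s sum_constant c
      using m by (simp add: field_simps power2_eq_square power3_eq_cube power4_eq_xxxx)
  qed
  have "(\<Sum>i\<in>A. \<Sum>j\<in>A - {i}. (x i * x j + ((x i)\<^sup>2 + (x j)\<^sup>2) / (2 * m))\<^sup>2)
      = (1 + 1 / (2 * m\<^sup>2)) * (T\<^sup>2 - B) - 2 / m * B + 1 / (4 * m) * B
        + 1 / (4 * m\<^sup>2) * ((m + 1) * B - B)"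
    by (simp only: inner sum.distrib sum_subtractf sum_distrib_left[symmetric]
        sum_distrib_right[symmetric] sq[folded sum_distrib_left] zero sum_constant card flip: B_def cong: sum.cong)
  also have "\<dots> = (1 + 1 / (2 * m\<^sup>2)) * (T\<^sup>2 - B) - 3 / (2 * m) * B"
    using m by (simp add: field_simps power2_eq_square)
  also have "\<dots> \<le> (1 + 1 / (2 * m\<^sup>2)) * (T\<^sup>2 - B)"
    using m B_nonneg by simp
  also have "\<dots> \<le> real (card A) / m * (T\<^sup>2 - B)"
  proof (rule mult_right_mono[OF _ TB])
    \<comment> \<open>The right side is \<open>1 + 1 / m\<close>, so \<open>m \<ge> 1\<close>
      suffices.\<close>
    show "1 + 1 / (2 * m\<^sup>2) \<le> real (card A) / m"
      unfolding card using m by (simp add: field_simps power2_eq_square)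
  qed
  finally show ?thesis by (simp add: T_def B_def)
qed

theorem proposition4:
  fixes n :: nat and x :: "nat \<Rightarrow> real"
  assumes "n \<ge> 2"
    and "(\<Sum>i=1..n. x i) = 0"
  shows "1 / fact n *
      (\<Sum>\<sigma> | \<sigma> permutes {1..n}.
        MAX k\<in>{2..n}.
          \<bar>((\<Sum>i=1..k. x (\<sigma> i))\<^sup>2
              - (real n - real k) / (real n - 1) * (\<Sum>i=1..k. (x (\<sigma> i))\<^sup>2))
            / (real k * (real k - 1))\<bar>\<^sup>2)
    \<le> 4 / (real n - 1)\<^sup>2 * ((\<Sum>i=1..n. (x i)\<^sup>2)\<^sup>2 - (\<Sum>i=1..n. x i ^ 4))"
proof -
  let ?P = "{\<sigma>. \<sigma> permutes {1..n}}"
  let ?R = "(\<Sum>i=1..n. (x i)\<^sup>2)\<^sup>2 - (\<Sum>i=1..n. x i ^ 4)"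
  let ?g = "\<lambda>i j. (x i * x j + ((x i)\<^sup>2 + (x j)\<^sup>2) / (2 * (real n - 1)))\<^sup>2"
  have n: "real n - 1 \<ge> 1" using assms(1) by simp
  have stat: "((\<Sum>i=1..k. x (\<sigma> i))\<^sup>2
        - (real n - real k) / (real n - 1) * (\<Sum>i=1..k. (x (\<sigma> i))\<^sup>2)) / (real k * (real k - 1))
      = prefix_stat n x (\<sigma> ` {1..k})" if "\<sigma> \<in> ?P" for \<sigma> k
    using that
    by (simp add: prefix_stat_def sum.reindex permutes_inj_on card_image)
  \<comment> \<open>For \<open>k = 2\<close> the weight is
    \<open>(n - 2) / (n - 1) = 1 - 1 / (n - 1)\<close>; the squares cancel up to the fraction
    \<open>1 / (n - 1)\<close>.\<close>
  have two: "(prefix_stat n x (\<sigma> ` {1..2}))\<^sup>2 = ?g (\<sigma> 1) (\<sigma> 2)" if "\<sigma> \<in> ?P" for \<sigma>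
  proof -
    have "{1..2} = {1, 2::nat}" by auto
    then show ?thesis
      unfolding stat[OF that, symmetric]
      using n by (intro arg_cong[where f = "\<lambda>t. t\<^sup>2"]) (simp add: field_simps power2_eq_square)
  qed
  have "1 / fact n * (\<Sum>\<sigma>\<in>?P. MAX k\<in>{2..n}. \<bar>prefix_stat n x (\<sigma> ` {1..k})\<bar>\<^sup>2)
      \<le> 1 / fact n * (4 * (\<Sum>\<sigma>\<in>?P. (prefix_stat n x (\<sigma> ` {1..2}))\<^sup>2))"
    by (intro mult_left_mono sum_permutes_maximal_inequality prefix_stat_average)
      (use assms(1) in auto)
  also have "(\<Sum>\<sigma>\<in>?P. (prefix_stat n x (\<sigma> ` {1..2}))\<^sup>2) = (\<Sum>\<sigma>\<in>?P. ?g (\<sigma> 1) (\<sigma> 2))"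
    by (intro sum.cong refl two)
  also have "\<dots> = fact n / (real n * (real n - 1)) * (\<Sum>i=1..n. \<Sum>j\<in>{1..n} - {i}. ?g i j)"
    using sum_permutes_two_points[of "{1..n}" 1 2 ?g] assms(1) by (simp add: field_simps)
  also have "1 / fact n * (4 * \<dots>)
      = 4 / (real n * (real n - 1)) * (\<Sum>i=1..n. \<Sum>j\<in>{1..n} - {i}. ?g i j)"
    by simp
  \<comment> \<open>The factor \<open>real n\<close> in the moment bound cancels the one from
    counting ordered pairs, leaving \<open>(real n - 1)\<^sup>2\<close> in the denominator.\<close>
  also have "\<dots> \<le> 4 / (real n * (real n - 1)) * (real n / (real n - 1) * ?R)"
    using sum_sum_off_diagonal_square_le[of "{1..n}" x] assms n by (intro mult_left_mono) auto
  also have "\<dots> = 4 / (real n - 1)\<^sup>2 * ?R"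
    using n by (simp add: power2_eq_square)
  finally show ?thesis
    by (simp only: stat cong: sum.cong)
qed

end
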